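(* Let $(\boldsymbol{x},\boldsymbol{\nu}_1,\boldsymbol{\nu}_2):U\to H^3\times\Delta_5$ be a hyperbolic generalized framed surface with basic invariants $a_i,b_i,c_i,e_i,f_i,g_i$, $i=1,2$. If there exists a smooth function $\theta:U\to\mathbb{R}$ such that $(a_1\cos\theta-b_1\sin\theta)(u,v)=(a_2\cos\theta-b_2\sin\theta)(u,v)=0$ for all $(u,v)\in U$, then $\boldsymbol{x}$ is a hyperbolic framed base surface.
   Context: $\mathbb{R}^4_1$ is $\mathbb{R}^4$ with the pseudo inner product $\langle \boldsymbol{x},\boldsymbol{y}\rangle=-x_1y_1+x_2y_2+x_3y_3+x_4y_4$. The pseudo vector product $\boldsymbol{x}\wedge\boldsymbol{y}\wedge\boldsymbol{z}$ of three vectors of $\mathbb{R}^4_1$ is the unique vector with $\langle \boldsymbol{w},\boldsymbol{x}\wedge\boldsymbol{y}\wedge\boldsymbol{z}\rangle=\det(\boldsymbol{w},\boldsymbol{x},\boldsymbol{y},\boldsymbol{z})$ for all $\boldsymbol{w}\in\mathbb{R}^4_1$. $H^3=\{\boldsymbol{x}\in\mathbb{R}^4_1: \langle\boldsymbol{x},\boldsymbol{x}\rangle=-1,\ x_1>0\}$, $S^3_1=\{\boldsymbol{x}\in\mathbb{R}^4_1:\langle\boldsymbol{x},\boldsymbol{x}\rangle=1\}$, $\Delta_5=\{(\boldsymbol{\nu}_1,\boldsymbol{\nu}_2)\in S^3_1\times S^3_1:\langle\boldsymbol{\nu}_1,\boldsymbol{\nu}_2\rangle=0\}$. $U$ is a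 simply connected open subset of $\mathbb{R}^2$ with coordinates $(u,v)$; subscripts $u,v$ denote partial derivatives; all maps are $C^\infty$. Hyperbolic framed surface: a smooth map $(\boldsymbol{x},\boldsymbol{n},\boldsymbol{s}):U\to H^3\times\Delta_5$ with $\langle\boldsymbol{x}_u,\boldsymbol{n}\rangle=\langle\boldsymbol{x}_v,\boldsymbol{n}\rangle=\langle\boldsymbol{x},\boldsymbol{n}\rangle=\langle\boldsymbol{x},\boldsymbol{s}\rangle=0$ on $U$. A smooth map $\boldsymbol{x}:U\to H^3$ is a hyperbolic framed base surface if there is a smooth $(\boldsymbol{n},\boldsymbol{s}):U\to\Delta_5$ such that $(\boldsymbol{x},\boldsymbol{n},\boldsymbol{s})$ is a hyperbolic framed surface. Hyperbolic generalized framed surface: a smooth map $(\boldsymbol{x},\boldsymbol{\nu}_1,\boldsymbol{\nu}_2):U\to H^3\times\Delta_5$ with $\langle\boldsymbol{x},\boldsymbol{\nu}_1\rangle=\langle\boldsymbol{x},\boldsymbol{\nu}_2\rangle=0$ on $U$ for which there are smooth functions $\alpha,\beta:U\to\mathbb{R}$ with $\boldsymbol{x}\wedge\boldsymbol{x}_u\wedge\boldsymbol{x}_v=\alpha\boldsymbol{\nu}_1+\beta\boldsymbol{\nu}_2$ on $U$. With $\boldsymbol{\nu}_3=\boldsymbol{x}\wedge\boldsymbol{\nu}_1\wedge\boldsymbol{\nu}_2$, its basic invariants are the smooth functions given by $\boldsymbol{x}_u=a_1\boldsymbol{\nu}_1+b_1\boldsymbol{\nu}_2+c_1\boldsymbol{\nu}_3$,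 $\boldsymbol{\nu}_{1u}=a_1\boldsymbol{x}+e_1\boldsymbol{\nu}_2+f_1\boldsymbol{\nu}_3$, $\boldsymbol{\nu}_{2u}=b_1\boldsymbol{x}-e_1\boldsymbol{\nu}_1+g_1\boldsymbol{\nu}_3$, $\boldsymbol{\nu}_{3u}=c_1\boldsymbol{x}-f_1\boldsymbol{\nu}_1-g_1\boldsymbol{\nu}_2$, and the same formulas with $u$ replaced by $v$ and index $1$ by $2$. *)

theory Defs
  imports "HOL-Analysis.Analysis"
begin

primrec Ck_on ::
  "nat \<Rightarrow> 'a::real_normed_vector set \<Rightarrow> ('a \<Rightarrow> 'b::real_normed_vector) \<Rightarrow> bool" where
  "Ck_on 0 S f \<longleftrightarrow> continuous_on S f"
| "Ck_on (Suc k) S f \<longleftrightarrow>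
     (\<forall>p\<in>S. f differentiable (at p)) \<and>
     (\<forall>h. Ck_on k S (\<lambda>p. frechet_derivative f (at p) h))"

text \<open>Meant for open \<open>S\<close> in a finite-dimensional space, where it is the usual
  \<open>C\<^sup>\<infinity>\<close> condition: derivatives are taken at points of \<open>S\<close> in the
  ambient space, so values off \<open>S\<close> are irrelevant.\<close>

definition smooth_on :: "'a::real_normed_vector set \<Rightarrow> ('a \<Rightarrow> 'b::real_normed_vector) \<Rightarrow> bool" where
  "smooth_on S f \<longleftrightarrow> (\<forall>k. Ck_on k S f)"

definition partial_u :: "(real \<times> real \<Rightarrow> 'b::real_normed_vector) \<Rightarrow> real \<times> real \<Rightarrow> 'b" where
  "partial_u f p = vector_derivative (\<lambda>t. f (t, snd p)) (at (fst p))"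

definition partial_v :: "(real \<times> real \<Rightarrow> 'b::real_normed_vector) \<Rightarrow> real \<times> real \<Rightarrow> 'b" where
  "partial_v f p = vector_derivative (\<lambda>t. f (fst p, t)) (at (snd p))"

definition lorentz :: "real^4 \<Rightarrow> real^4 \<Rightarrow> real" where
  "lorentz x y = - (x$1 * y$1) + x$2 * y$2 + x$3 * y$3 + x$4 * y$4"

definition det4 :: "real^4 \<Rightarrow> real^4 \<Rightarrow> real^4 \<Rightarrow> real^4 \<Rightarrow> real" where
  "det4 w x y z = det (vector [w, x, y, z] :: real^4^4)"

definition wedge3 :: "real^4 \<Rightarrow> real^4 \<Rightarrow> real^4 \<Rightarrow> real^4" where
  "wedge3 x y z = (THE p. \<forall>w. lorentz w p = det4 w x y z)"

lemma vector_rows_4: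
  "(vector [w, x, y, z] :: real^4^4) = (\<chi> i. if i = 1 then w else
     if i = 2 then x else if i = 3 then y else z)"
  by (simp add: vec_eq_iff forall_4 vector_def)

lemma det4_linear: "linear (\<lambda>w. det4 w x y z)"
proof -
  let ?c = "\<lambda>i::4. if i = 2 then x else if i = 3 then y else z"
  have eq: "det4 w x y z = det ((\<chi> i. if i = 1 then w else ?c i) :: real^4^4)" for w
    unfolding det4_def vector_rows_4 ..
  show ?thesis
  proof (rule linearI)
    show "det4 (v + w) x y z = det4 v x y z + det4 w x y z" for v w
      unfolding eq by (rule det_row_add)
    show "det4 (r *\<^sub>R w) x y z = r *\<^sub>R det4 w x y z" for r w
      unfolding eq using det_row_mul[of 1 r "\<lambda>_. w" ?c]
      by (simp add: scalar_mult_eq_scaleR cong: if_cong)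
  qed
qed

lemma ex1_wedge3: "\<exists>!p. \<forall>w. lorentz w p = det4 w x y z"
proof
  let ?d = "\<lambda>i. det4 (axis i 1) x y z"
  let ?p = "(\<chi> i. if i = 1 then - ?d 1 else ?d i) :: real^4"
  show "\<forall>w. lorentz w ?p = det4 w x y z"
  proof
    fix w :: "real^4"
    have w: "w = (\<Sum>i\<in>UNIV. (w$i) *\<^sub>R axis i 1)"
      by (simp add: vec_eq_iff axis_def if_distrib cong: if_cong)
    have "det4 w x y z = (\<Sum>i\<in>UNIV. w$i * ?d i)"
      by (subst w) (simp add: linear_sum[OF det4_linear] linear_scale[OF det4_linear])
    then show "lorentz w ?p = det4 w x y z"
      by (simp add: lorentz_def sum_4)
  qed
  fix q assume q: "\<forall>w. lorentz w q = det4 w x y z"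
  have "lorentz (axis i 1) q = ?d i" for i using q by blast
  from this[of 1] this[of 2] this[of 3] this[of 4] show "q = ?p"
    by (simp add: vec_eq_iff forall_4 lorentz_def axis_def)
qed

lemma lorentz_wedge3: "lorentz w (wedge3 x y z) = det4 w x y z"
  using theI'[OF ex1_wedge3, of x y z] unfolding wedge3_def by blast

definition H3 :: "(real^4) set" where
  "H3 = {x. lorentz x x = -1 \<and> x$1 > 0}"

definition S31 :: "(real^4) set" where
  "S31 = {x. lorentz x x = 1}"

definition Delta5 :: "((real^4) \<times> (real^4)) set" where
  "Delta5 = {(v, w). v \<in> S31 \<and> w \<in> S31 \<and> lorentz v w = 0}"

text \<open>A map on \<open>U\<close> is a total function of which only the values on \<open>U\<close> matter;
  a smooth map into the submanifold \<open>H3\<close> or \<open>Delta5\<close> is a map taking values there that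
  is smooth as a map into \<open>real^4\<close>, respectively componentwise.\<close>

definition hyperbolic_framed_surface ::
  "(real \<times> real) set \<Rightarrow> (real \<times> real \<Rightarrow> real^4) \<Rightarrow> (real \<times> real \<Rightarrow> real^4) \<Rightarrow>
   (real \<times> real \<Rightarrow> real^4) \<Rightarrow> bool" where
  "hyperbolic_framed_surface U x n s \<longleftrightarrow>
     smooth_on U x \<and> smooth_on U n \<and> smooth_on U s \<and>
     (\<forall>p\<in>U. x p \<in> H3 \<and> (n p, s p) \<in> Delta5 \<and>
        lorentz (partial_u x p) (n p) = 0 \<and> lorentz (partial_v x p) (n p) = 0 \<and>
        lorentz (x p) (n p) = 0 \<and> lorentz (x p) (s p) = 0)"

definition hyperbolic_framed_base_surface ::
  "(real \<times> real) set \<Rightarrow> (real \<times> real \<Rightarrow> real^4) \<Rightarrow> bool" where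
  "hyperbolic_framed_base_surface U x \<longleftrightarrow> (\<exists>n s. hyperbolic_framed_surface U x n s)"

definition hyperbolic_generalized_framed_surface ::
  "(real \<times> real) set \<Rightarrow> (real \<times> real \<Rightarrow> real^4) \<Rightarrow> (real \<times> real \<Rightarrow> real^4) \<Rightarrow>
   (real \<times> real \<Rightarrow> real^4) \<Rightarrow> bool" where
  "hyperbolic_generalized_framed_surface U x \<nu>1 \<nu>2 \<longleftrightarrow>
     smooth_on U x \<and> smooth_on U \<nu>1 \<and> smooth_on U \<nu>2 \<and>
     (\<forall>p\<in>U. x p \<in> H3 \<and> (\<nu>1 p, \<nu>2 p) \<in> Delta5 \<and>
        lorentz (x p) (\<nu>1 p) = 0 \<and> lorentz (x p) (\<nu>2 p) = 0) \<and>
     (\<exists>\<alpha> \<beta> :: real \<times> real \<Rightarrow> real. smooth_on U \<alpha> \<and> smooth_on U \<beta> \<and>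
        (\<forall>p\<in>U. wedge3 (x p) (partial_u x p) (partial_v x p) = \<alpha> p *\<^sub>R \<nu>1 p + \<beta> p *\<^sub>R \<nu>2 p))"

definition nu3 ::
  "(real \<times> real \<Rightarrow> real^4) \<Rightarrow> (real \<times> real \<Rightarrow> real^4) \<Rightarrow> (real \<times> real \<Rightarrow> real^4) \<Rightarrow>
   real \<times> real \<Rightarrow> real^4" where
  "nu3 x \<nu>1 \<nu>2 p = wedge3 (x p) (\<nu>1 p) (\<nu>2 p)"

text \<open>The structure equations along one coordinate, \<open>D\<close> being the corresponding partial
  derivative operator.\<close>

definition structure_equations ::
  "((real \<times> real \<Rightarrow> real^4) \<Rightarrow> real \<times> real \<Rightarrow> real^4) \<Rightarrow> (real \<times> real) set \<Rightarrow>
   (real \<times> real \<Rightarrow> real^4) \<Rightarrow> (real \<times> real \<Rightarrow> real^4) \<Rightarrow> (real \<times> real \<Rightarrow> real^4) \<Rightarrow>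
   (real \<times> real \<Rightarrow> real) \<Rightarrow> (real \<times> real \<Rightarrow> real) \<Rightarrow> (real \<times> real \<Rightarrow> real) \<Rightarrow>
   (real \<times> real \<Rightarrow> real) \<Rightarrow> (real \<times> real \<Rightarrow> real) \<Rightarrow> (real \<times> real \<Rightarrow> real) \<Rightarrow> bool" where
  "structure_equations D U x \<nu>1 \<nu>2 a b c e f g \<longleftrightarrow>
     (\<forall>p\<in>U.
        D x p = a p *\<^sub>R \<nu>1 p + b p *\<^sub>R \<nu>2 p + c p *\<^sub>R nu3 x \<nu>1 \<nu>2 p \<and>
        D \<nu>1 p = a p *\<^sub>R x p + e p *\<^sub>R \<nu>2 p + f p *\<^sub>R nu3 x \<nu>1 \<nu>2 p \<and>
        D \<nu>2 p = b p *\<^sub>R x p - e p *\<^sub>R \<nu>1 p + g p *\<^sub>R nu3 x \<nu>1 \<nu>2 p \<and>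
        D (nu3 x \<nu>1 \<nu>2) p = c p *\<^sub>R x p - f p *\<^sub>R \<nu>1 p - g p *\<^sub>R \<nu>2 p)"

text \<open>For a hyperbolic generalized framed surface, \<open>x, \<nu>1, \<nu>2, nu3\<close> is pointwise a
  pseudo-orthonormal basis, so these equations have exactly one solution on \<open>U\<close>, which is
  smooth; the predicate says that the twelve functions are that solution.\<close>

definition basic_invariants ::
  "(real \<times> real) set \<Rightarrow>
   (real \<times> real \<Rightarrow> real^4) \<Rightarrow> (real \<times> real \<Rightarrow> real^4) \<Rightarrow> (real \<times> real \<Rightarrow> real^4) \<Rightarrow>
   (real \<times> real \<Rightarrow> real) \<Rightarrow> (real \<times> real \<Rightarrow> real) \<Rightarrow> (real \<times> real \<Rightarrow> real) \<Rightarrow>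
   (real \<times> real \<Rightarrow> real) \<Rightarrow> (real \<times> real \<Rightarrow> real) \<Rightarrow> (real \<times> real \<Rightarrow> real) \<Rightarrow>
   (real \<times> real \<Rightarrow> real) \<Rightarrow> (real \<times> real \<Rightarrow> real) \<Rightarrow> (real \<times> real \<Rightarrow> real) \<Rightarrow>
   (real \<times> real \<Rightarrow> real) \<Rightarrow> (real \<times> real \<Rightarrow> real) \<Rightarrow> (real \<times> real \<Rightarrow> real) \<Rightarrow> bool" where
  "basic_invariants U x \<nu>1 \<nu>2 a1 b1 c1 e1 f1 g1 a2 b2 c2 e2 f2 g2 \<longleftrightarrow>
     (\<forall>h \<in> {a1, b1, c1, e1, f1, g1, a2, b2, c2, e2, f2, g2}. smooth_on U h) \<and>
     structure_equations partial_u U x \<nu>1 \<nu>2 a1 b1 c1 e1 f1 g1 \<and>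
     structure_equations partial_v U x \<nu>1 \<nu>2 a2 b2 c2 e2 f2 g2"

end

theory Submission
  imports Defs
begin

text \<open>The hypothesis on \<open>\<theta>\<close> says that, in the frame \<open>\<nu>1, \<nu>2, \<nu>3\<close> orthogonal to \<open>x\<close>, both
  \<open>x\<^sub>u\<close> and \<open>x\<^sub>v\<close> are orthogonal to \<open>n = cos \<theta> \<nu>1 - sin \<theta> \<nu>2\<close>: by the structure equations,
  \<open>a\<^sub>i\<close> and \<open>b\<^sub>i\<close> are their \<open>\<nu>1\<close> and \<open>\<nu>2\<close> components, and \<open>\<nu>3\<close>, being a
  pseudo vector product containing \<open>\<nu>1\<close> and \<open>\<nu>2\<close>, is orthogonal to both. So \<open>n\<close> is a normal
  of \<open>x\<close>. Completing the rotation of the pair \<open>(\<nu>1, \<nu>2)\<close> by the angle \<open>\<theta>\<close> with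
  \<open>s = sin \<theta> \<nu>1 + cos \<theta> \<nu>2\<close> keeps the pair orthonormal and orthogonal to \<open>x\<close>.

  What remains is the smoothness of \<open>n\<close> and \<open>s\<close>, that is, closure of \<open>C\<^sup>k\<close> maps on an open set
  under sums, products, and composition with sine and cosine. Each closure property is an
  induction on \<open>k\<close>: the directional derivatives of the compound map are given by the Leibniz
  or chain rule, and have the same form with \<open>C\<^sup>k\<close> ingredients.\<close>

section \<open>Closure properties of smooth maps\<close>

lemma Ck_on_cong:
  assumes "open S" "\<And>p. p \<in> S \<Longrightarrow> f p = g p" "Ck_on k S f"
  shows "Ck_on k S g"
  using assms(2,3)
proof (induction k arbitrary: f g)
  case 0
  then show ?case using continuous_on_cong[of S S f g] by simp
next
  case (Suc k)
  have g: "(g has_derivative frechet_derivative f (at p)) (at p)" if "p \<in> S" for p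
  proof (rule has_derivative_transform_within_open[OF _ assms(1) that])
    show "(f has_derivative frechet_derivative f (at p)) (at p)"
      using Suc.prems(2) that frechet_derivative_works by auto
  qed (use Suc.prems(1) in auto)
  then have "frechet_derivative f (at p) h = frechet_derivative g (at p) h" if "p \<in> S" for p h
    using frechet_derivative_at that by metis
  then have "Ck_on k S (\<lambda>p. frechet_derivative g (at p) h)" for h
    using Suc.IH[of "\<lambda>p. frechet_derivative f (at p) h"] Suc.prems(2) by simp
  with g show ?case by (auto simp: differentiable_def)
qed

text \<open>An introduction rule for use with an explicit derivative in place of
  \<open>frechet_derivative\<close>. The two agree only on \<open>S\<close>, so \<open>C\<^sup>k\<close> must not depend on values off
  \<open>S\<close>, which is where openness enters.\<close>

lemma Ck_on_SucI:
  assumes "open S" "\<And>p. p \<in> S \<Longrightarrow> (f has_derivative f' p) (at p)"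
    and "\<And>h. Ck_on k S (\<lambda>p. f' p h)"
  shows "Ck_on (Suc k) S f"
proof -
  have "f' p h = frechet_derivative f (at p) h" if "p \<in> S" for p h
    using frechet_derivative_at[OF assms(2)[OF that]] by simp
  then have "Ck_on k S (\<lambda>p. frechet_derivative f (at p) h)" for h
    using Ck_on_cong[OF assms(1) _ assms(3)[of h]] by simp
  with assms(2) show ?thesis by (auto simp: differentiable_def)
qed

lemma Ck_on_Suc_has_derivative:
  assumes "Ck_on (Suc k) S f" "p \<in> S"
  shows "(f has_derivative frechet_derivative f (at p)) (at p)"
  using assms frechet_derivative_works by auto

lemma Ck_on_Suc_imp_Ck_on:
  assumes "open S" "Ck_on (Suc k) S f"
  shows "Ck_on k S f"
  using assms(2)
proof (induction k arbitrary: f)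
  case 0
  then show ?case
    by (auto intro!: differentiable_imp_continuous_on
        simp: differentiable_on_def differentiable_at_withinI)
next
  case (Suc k)
  show ?case
    by (rule Ck_on_SucI[OF assms(1) Ck_on_Suc_has_derivative[OF Suc.prems]])
      (use Suc in auto)
qed

lemma Ck_on_add:
  assumes "open S" "Ck_on k S f" "Ck_on k S g"
  shows "Ck_on k S (\<lambda>p. f p + g p)"
  using assms(2,3)
proof (induction k arbitrary: f g)
  case 0
  then show ?case by (simp add: continuous_on_add)
next
  case (Suc k)
  show ?case
    by (rule Ck_on_SucI[OF assms(1)
          has_derivative_add[OF Suc.prems[THEN Ck_on_Suc_has_derivative]]])
      (use Suc in auto)
qed

lemma (in bounded_linear) Ck_on:
  assumes "open S" "Ck_on k S g"
  shows "Ck_on k S (\<lambda>p. f (g p))"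
  using assms(2)
proof (induction k arbitrary: g)
  case 0
  then show ?case by (simp add: continuous_on)
next
  case (Suc k)
  show ?case
    by (rule Ck_on_SucI[OF assms(1)
          has_derivative[OF Ck_on_Suc_has_derivative[OF Suc.prems]]])
      (use Suc in auto)
qed

lemma Ck_on_bounded_bilinear:
  assumes "bounded_bilinear B" "open S" "Ck_on k S f" "Ck_on k S g"
  shows "Ck_on k S (\<lambda>p. B (f p) (g p))"
  using assms(3,4)
proof (induction k arbitrary: f g)
  case 0
  then show ?case by (simp add: bounded_bilinear.continuous_on[OF assms(1)])
next
  case (Suc k)
  note lower = Suc.prems[THEN Ck_on_Suc_imp_Ck_on[OF assms(2)]]
  show ?case
    by (rule Ck_on_SucI[OF assms(2)
          bounded_bilinear.FDERIV[OF assms(1) Suc.prems[THEN Ck_on_Suc_has_derivative]]])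
      (use Suc lower in \<open>auto intro!: Ck_on_add[OF assms(2)]\<close>)
qed

text \<open>Sine and cosine are treated together because each is the derivative of the other up to
  sign, so that the induction hypothesis for one serves the other.\<close>

lemma Ck_on_sin_cos:
  fixes \<theta> :: "'a::real_normed_vector \<Rightarrow> real"
  assumes "open S" "Ck_on k S \<theta>"
  shows "Ck_on k S (\<lambda>p. sin (\<theta> p)) \<and> Ck_on k S (\<lambda>p. cos (\<theta> p))"
  using assms(2)
proof (induction k)
  case 0
  then show ?case by (simp add: continuous_on_sin continuous_on_cos)
next
  case (Suc k)
  note IH = Suc.IH[OF Ck_on_Suc_imp_Ck_on[OF assms(1) Suc.prems]]
  let ?\<theta>' = "\<lambda>p. frechet_derivative \<theta> (at p)"
  have \<theta>': "Ck_on k S (\<lambda>p. ?\<theta>' p h)" for h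
    using Suc.prems by simp
  have "Ck_on (Suc k) S (\<lambda>p. sin (\<theta> p))"
  proof (rule Ck_on_SucI[OF assms(1)])
    show "((\<lambda>p. sin (\<theta> p)) has_derivative (\<lambda>h. ?\<theta>' p h * cos (\<theta> p))) (at p)"
      if "p \<in> S" for p
      using Ck_on_Suc_has_derivative[OF Suc.prems that] by (auto intro!: derivative_eq_intros)
    show "Ck_on k S (\<lambda>p. ?\<theta>' p h * cos (\<theta> p))" for h
      using Ck_on_bounded_bilinear[OF bounded_bilinear_mult assms(1) \<theta>'] IH by blast
  qed
  moreover have "Ck_on (Suc k) S (\<lambda>p. cos (\<theta> p))"
  proof (rule Ck_on_SucI[OF assms(1)])
    show "((\<lambda>p. cos (\<theta> p)) has_derivative (\<lambda>h. - (?\<theta>' p h * sin (\<theta> p)))) (at p)"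
      if "p \<in> S" for p
      using Ck_on_Suc_has_derivative[OF Suc.prems that] by (auto intro!: derivative_eq_intros)
    show "Ck_on k S (\<lambda>p. - (?\<theta>' p h * sin (\<theta> p)))" for h
      using bounded_linear.Ck_on[OF bounded_linear_minus[OF bounded_linear_ident] assms(1)]
        Ck_on_bounded_bilinear[OF bounded_bilinear_mult assms(1) \<theta>'] IH by blast
  qed
  ultimately show ?case ..
qed

lemma smooth_on_add:
  "open S \<Longrightarrow> smooth_on S f \<Longrightarrow> smooth_on S g \<Longrightarrow> smooth_on S (\<lambda>p. f p + g p)"
  by (simp add: smooth_on_def Ck_on_add)

lemma smooth_on_minus:
  "open S \<Longrightarrow> smooth_on S f \<Longrightarrow> smooth_on S (\<lambda>p. - f p)"
  by (simp add: smooth_on_def bounded_linear.Ck_on[OF bounded_linear_minus[OF bounded_linear_ident]])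

lemma smooth_on_diff:
  "open S \<Longrightarrow> smooth_on S f \<Longrightarrow> smooth_on S g \<Longrightarrow> smooth_on S (\<lambda>p. f p - g p)"
  using smooth_on_add[of S f "\<lambda>p. - g p"] by (simp add: smooth_on_minus)

lemma smooth_on_scaleR:
  "open S \<Longrightarrow> smooth_on S f \<Longrightarrow> smooth_on S g \<Longrightarrow> smooth_on S (\<lambda>p. f p *\<^sub>R g p)"
  by (simp add: smooth_on_def Ck_on_bounded_bilinear[OF bounded_bilinear_scaleR])

lemma smooth_on_sin:
  fixes \<theta> :: "'a::real_normed_vector \<Rightarrow> real"
  shows "open S \<Longrightarrow> smooth_on S \<theta> \<Longrightarrow> smooth_on S (\<lambda>p. sin (\<theta> p))"
  by (simp add: smooth_on_def Ck_on_sin_cos)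

lemma smooth_on_cos:
  fixes \<theta> :: "'a::real_normed_vector \<Rightarrow> real"
  shows "open S \<Longrightarrow> smooth_on S \<theta> \<Longrightarrow> smooth_on S (\<lambda>p. cos (\<theta> p))"
  by (simp add: smooth_on_def Ck_on_sin_cos)

section \<open>The pseudo inner product and rotation of orthonormal pairs\<close>

lemma lorentz_commute: "lorentz x y = lorentz y x"
  by (simp add: lorentz_def mult.commute)

lemma lorentz_algebra:
  "lorentz (x + y) z = lorentz x z + lorentz y z"
  "lorentz z (x + y) = lorentz z x + lorentz z y"
  "lorentz (x - y) z = lorentz x z - lorentz y z"
  "lorentz z (x - y) = lorentz z x - lorentz z y"
  "lorentz (c *\<^sub>R x) z = c * lorentz x z"
  "lorentz z (c *\<^sub>R x) = c * lorentz z x"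
  by (simp_all add: lorentz_def algebra_simps)

lemma lorentz_wedge3_factor:
  "lorentz y (wedge3 x y z) = 0" "lorentz z (wedge3 x y z) = 0"
proof -
  have "det4 y x y z = 0"
    unfolding det4_def vector_rows_4
    by (rule det_identical_rows[of 1 3]) (simp_all add: row_def vec_eq_iff)
  moreover have "det4 z x y z = 0"
    unfolding det4_def vector_rows_4
    by (rule det_identical_rows[of 1 4]) (simp_all add: row_def vec_eq_iff)
  ultimately show "lorentz y (wedge3 x y z) = 0" "lorentz z (wedge3 x y z) = 0"
    by (simp_all add: lorentz_wedge3)
qed

lemma Delta5_rotate:
  assumes "(v, w) \<in> Delta5"
  shows "(cos t *\<^sub>R v - sin t *\<^sub>R w, sin t *\<^sub>R v + cos t *\<^sub>R w) \<in> Delta5"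
proof -
  have vw: "lorentz v v = 1" "lorentz w w = 1" "lorentz v w = 0" "lorentz w v = 0"
    using assms lorentz_commute[of w v] by (auto simp: Delta5_def S31_def)
  show ?thesis
    using sin_cos_squared_add3[of t]
    by (simp add: Delta5_def S31_def lorentz_algebra vw algebra_simps)
qed

lemma lorentz_rotated_normal:
  assumes "(v, w) \<in> Delta5"
  shows "lorentz (a *\<^sub>R v + b *\<^sub>R w + c *\<^sub>R wedge3 x v w) (cos t *\<^sub>R v - sin t *\<^sub>R w)
    = a * cos t - b * sin t"
proof -
  have vw: "lorentz v v = 1" "lorentz w w = 1" "lorentz v w = 0" "lorentz w v = 0"
    using assms lorentz_commute[of w v] by (auto simp: Delta5_def S31_def)
  have "lorentz (wedge3 x v w) v = 0" "lorentz (wedge3 x v w) w = 0"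
    using lorentz_wedge3_factor[where x = x and y = v and z = w] by (simp_all add: lorentz_commute)
  then show ?thesis
    by (simp add: lorentz_algebra vw algebra_simps)
qed

section \<open>Generalized framed surfaces with a rotated normal\<close>

theorem proposition3p11:
  fixes U :: "(real \<times> real) set"
    and x \<nu>1 \<nu>2 :: "real \<times> real \<Rightarrow> real^4"
    and a1 b1 c1 e1 f1 g1 a2 b2 c2 e2 f2 g2 :: "real \<times> real \<Rightarrow> real"
  assumes "open U" and "simply_connected U"
    and "hyperbolic_generalized_framed_surface U x \<nu>1 \<nu>2"
    and "basic_invariants U x \<nu>1 \<nu>2 a1 b1 c1 e1 f1 g1 a2 b2 c2 e2 f2 g2"
    and "\<exists>\<theta> :: real \<times> real \<Rightarrow> real. smooth_on U \<theta> \<and>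
           (\<forall>p\<in>U. a1 p * cos (\<theta> p) - b1 p * sin (\<theta> p) = 0 \<and>
                  a2 p * cos (\<theta> p) - b2 p * sin (\<theta> p) = 0)"
  shows "hyperbolic_framed_base_surface U x"
proof -
  obtain \<theta> :: "real \<times> real \<Rightarrow> real" where \<theta>: "smooth_on U \<theta>"
    and \<theta>_eq: "\<And>p. p \<in> U \<Longrightarrow> a1 p * cos (\<theta> p) - b1 p * sin (\<theta> p) = 0"
      "\<And>p. p \<in> U \<Longrightarrow> a2 p * cos (\<theta> p) - b2 p * sin (\<theta> p) = 0"
    using assms(5) by blast
  have smooth: "smooth_on U x" "smooth_on U \<nu>1" "smooth_on U \<nu>2"
    and frame: "\<And>p. p \<in> U \<Longrightarrow> x p \<in> H3" "\<And>p. p \<in> U \<Longrightarrow> (\<nu>1 p, \<nu>2 p) \<in> Delta5"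
      "\<And>p. p \<in> U \<Longrightarrow> lorentz (x p) (\<nu>1 p) = 0" "\<And>p. p \<in> U \<Longrightarrow> lorentz (x p) (\<nu>2 p) = 0"
    using assms(3) unfolding hyperbolic_generalized_framed_surface_def by blast+
  have partials:
    "partial_u x p = a1 p *\<^sub>R \<nu>1 p + b1 p *\<^sub>R \<nu>2 p + c1 p *\<^sub>R wedge3 (x p) (\<nu>1 p) (\<nu>2 p)"
    "partial_v x p = a2 p *\<^sub>R \<nu>1 p + b2 p *\<^sub>R \<nu>2 p + c2 p *\<^sub>R wedge3 (x p) (\<nu>1 p) (\<nu>2 p)"
    if "p \<in> U" for p
    using assms(4) that
    unfolding basic_invariants_def structure_equations_def nu3_def by blast+
  let ?n = "\<lambda>p. cos (\<theta> p) *\<^sub>R \<nu>1 p - sin (\<theta> p) *\<^sub>R \<nu>2 p"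
  let ?s = "\<lambda>p. sin (\<theta> p) *\<^sub>R \<nu>1 p + cos (\<theta> p) *\<^sub>R \<nu>2 p"
  have "smooth_on U ?n" "smooth_on U ?s"
    by (intro smooth_on_add smooth_on_diff smooth_on_scaleR smooth_on_sin smooth_on_cos
        assms(1) \<theta> smooth)+
  moreover have "lorentz (partial_u x p) (?n p) = 0" "lorentz (partial_v x p) (?n p) = 0"
    if "p \<in> U" for p
    using that by (simp_all add: partials lorentz_rotated_normal frame \<theta>_eq)
  moreover have "lorentz (x p) (?n p) = 0" "lorentz (x p) (?s p) = 0" if "p \<in> U" for p
    using that by (simp_all add: lorentz_algebra frame)
  ultimately have "hyperbolic_framed_surface U x ?n ?s"
    unfolding hyperbolic_framed_surface_def using smooth frame Delta5_rotate by simp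
  then show ?thesis
    unfolding hyperbolic_framed_base_surface_def by blast
qed

end
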